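(* Let $X$ be a nonempty set and $Y$ a nonempty subset of $X$. The ideals of $\overline{\Omega}(X,Y)$ are precisely the sets of the form $J(F)$ for some nonempty subset $F$ of $\overline{\Omega}(X,Y)$; that is, a subset $I\subseteq\overline{\Omega}(X,Y)$ is an ideal of $\overline{\Omega}(X,Y)$ if and only if $I=J(F)$ for some nonempty $F\subseteq\overline{\Omega}(X,Y)$.
   Context: $T(X)$ is the semigroup of all maps $X\to X$ under composition; maps are written on the right and composed from left to right, so $x(fg)=(xf)g$, and for $B\subseteq X$, $Bf=\{xf\colon x\in B\}$. Let $\overline{\Omega}(X,Y)=\{f\in T(X)\colon Yf=Y\}$, a subsemigroup of $T(X)$. For $f\in\overline{\Omega}(X,Y)$, $f_{\upharpoonright Y}\colon Y\to Y$ denotes the (surjective) map that agrees with $f$ on $Y$, and for $y\in Y$, $y(f_{\upharpoonright Y})^{-1}=\{z\in Y\colon zf=y\}$. $|A|$ denotes the cardinality of $A$; sums and inequalities are of cardinal numbers. A partition $\{P_y\colon y\in Y\}$ of $Y$ is a family, indexed by $Y$, of pairwise disjoint nonempty subsets of $Y$ (for distinct indices) whose union is $Y$. For a nonempty subset $F$ of $\overline{\Omega}(X,Y)$, let $J(F)$ be the set of all $f\in\overline{\Omega}(X,Y)$ for which there exist $g\in F$ and a partition $\{P_y\colon y\in Y\}$ of $Y$ such that $|Xf\setminus Y|\leq|Xg\setminus Y|$ and $|y(f_{\upharpoonright Y})^{-1}|\geq\sum_{w\in P_y}|w(g_{\upharpoonright Y})^{-1}|$ for all $y\in Y$. An ideal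 of a semigroup $S$ is a nonempty subset $I\subseteq S$ with $SI\subseteq I$ and $IS\subseteq I$. *)

theory Defs
  imports "HOL-Library.FuncSet" "HOL-Library.Disjoint_Sets"
begin

unbundle cardinal_syntax

text \<open>
  Maps of a set \<open>X\<close> into itself are the extensional functions \<open>X \<rightarrow>\<^sub>E X\<close>, so that equality of
  maps on \<open>X\<close> is HOL equality.
\<close>

definition full_transformations :: "'a set \<Rightarrow> ('a \<Rightarrow> 'a) set" where
  "full_transformations X = X \<rightarrow>\<^sub>E X"

text \<open>Composition is from left to right: the product of \<open>f\<close> and \<open>g\<close> applies \<open>f\<close> first.\<close>

definition lr_comp :: "'a set \<Rightarrow> ('a \<Rightarrow> 'a) \<Rightarrow> ('a \<Rightarrow> 'a) \<Rightarrow> ('a \<Rightarrow> 'a)" where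
  "lr_comp X f g = compose X g f"

definition Omega_bar :: "'a set \<Rightarrow> 'a set \<Rightarrow> ('a \<Rightarrow> 'a) set" where
  "Omega_bar X Y = {f \<in> full_transformations X. f ` Y = Y}"

definition semigroup_ideal :: "'s set \<Rightarrow> ('s \<Rightarrow> 's \<Rightarrow> 's) \<Rightarrow> 's set \<Rightarrow> bool" where
  "semigroup_ideal S mul I \<longleftrightarrow>
     I \<noteq> {} \<and> I \<subseteq> S \<and>
     (\<forall>s\<in>S. \<forall>a\<in>I. mul s a \<in> I) \<and>
     (\<forall>a\<in>I. \<forall>s\<in>S. mul a s \<in> I)"

definition fibre_on :: "'a set \<Rightarrow> ('a \<Rightarrow> 'b) \<Rightarrow> 'b \<Rightarrow> 'a set" where
  "fibre_on Y f y = {z \<in> Y. f z = y}"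

text \<open>The values of \<open>P\<close> outside \<open>Y\<close> are irrelevant.\<close>

definition indexed_partition :: "'a set \<Rightarrow> ('a \<Rightarrow> 'a set) \<Rightarrow> bool" where
  "indexed_partition Y P \<longleftrightarrow>
     (\<forall>y\<in>Y. P y \<noteq> {}) \<and> disjoint_family_on P Y \<and> (\<Union>y\<in>Y. P y) = Y"

text \<open>
  Cardinalities may be infinite, so they are compared as cardinal-order relations, and the sum of
  cardinals is the library's \<open>Csum\<close>.
\<close>

definition J_set :: "'a set \<Rightarrow> 'a set \<Rightarrow> ('a \<Rightarrow> 'a) set \<Rightarrow> ('a \<Rightarrow> 'a) set" where
  "J_set X Y F =
     {f \<in> Omega_bar X Y. \<exists>g\<in>F. \<exists>P. indexed_partition Y P \<and>
        |f ` X - Y| \<le>o |g ` X - Y| \<and>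
        (\<forall>y\<in>Y. (CSUM w : |P y| . |fibre_on Y g w| ) \<le>o |fibre_on Y f y| )}"

end

theory Submission
  imports Defs
begin

text \<open>
  The set \<open>J_set X Y F\<close> is the two-sided ideal that \<open>F\<close> generates. As \<open>Omega_bar X Y\<close> is a monoid,
  this ideal consists of the products \<open>h g k\<close> (from left to right) with \<open>g \<in> F\<close>, and every ideal is
  the ideal generated by itself. So the theorem reduces to a criterion for \<open>f\<close> to be of the form
  \<open>h g k\<close> (\<open>in_J_set_iff_product\<close>).

  The fibres of \<open>g\<close> over the points of \<open>P\<close> partition the preimage of \<open>P\<close> in \<open>Y\<close>, so a sum of fibre
  cardinalities is the cardinality of a preimage (\<open>Csum_fibre_on\<close>). If \<open>f = h g k\<close>, then the fibres
  of \<open>k\<close> on \<open>Y\<close> are the required partition: \<open>h\<close> maps the fibre of \<open>f\<close> over \<open>y\<close> onto the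
  \<open>g\<close>-preimage of the fibre of \<open>k\<close> over \<open>y\<close>, and \<open>k\<close> maps a part of the points of \<open>Xg\<close> outside \<open>Y\<close>
  onto those of \<open>Xf\<close>.
  Conversely, a partition \<open>P\<close> determines \<open>k\<close> on \<open>Y\<close>, which sends \<open>P y\<close> to \<open>y\<close>. The cardinal
  inequalities on fibres supply surjections from the fibre of \<open>f\<close> over \<open>y\<close> to the \<open>g\<close>-preimage of
  \<open>P y\<close>; glued together they are \<open>h\<close> on \<open>Y\<close>. Outside \<open>Y\<close>, an injection of \<open>Xf \<setminus> Y\<close> into \<open>Xg \<setminus> Y\<close>
  tells \<open>h\<close> where to go and \<open>k\<close> how to come back.
\<close>

section \<open>The monoid of maps that map \<open>Y\<close> onto itself\<close>

lemma Omega_barI: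
  assumes "f \<in> X \<rightarrow>\<^sub>E X" and "f ` Y = Y"
  shows "f \<in> Omega_bar X Y"
  using assms by (simp add: Omega_bar_def full_transformations_def)

lemma Omega_barD:
  assumes "f \<in> Omega_bar X Y"
  shows "f \<in> X \<rightarrow>\<^sub>E X" and "f \<in> X \<rightarrow> X" and "f ` Y = Y"
  using assms by (auto simp: Omega_bar_def full_transformations_def)

lemma Omega_bar_maps:
  assumes "f \<in> Omega_bar X Y" and "y \<in> Y"
  shows "f y \<in> Y"
  using assms(2) imageI[of y Y f] by (simp add: Omega_barD(3)[OF assms(1)])

lemma Omega_bar_surj:
  assumes "f \<in> Omega_bar X Y" and "y \<in> Y"
  obtains x where "x \<in> Y" and "f x = y"
proof -
  have "y \<in> f ` Y" using assms(2) by (simp add: Omega_barD(3)[OF assms(1)])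
  then show ?thesis using that by blast
qed

lemma lr_comp_apply: "x \<in> X \<Longrightarrow> lr_comp X f g x = g (f x)"
  by (simp add: lr_comp_def compose_def)

lemma lr_comp_closed:
  assumes "Y \<subseteq> X" and "f \<in> Omega_bar X Y" and "g \<in> Omega_bar X Y"
  shows "lr_comp X f g \<in> Omega_bar X Y"
proof (rule Omega_barI)
  show "lr_comp X f g \<in> X \<rightarrow>\<^sub>E X"
    using Omega_barD(2)[OF assms(2)] Omega_barD(2)[OF assms(3)]
    by (auto simp: lr_comp_def compose_def)
  have "lr_comp X f g ` Y = g ` f ` Y"
    using assms(1) by (force simp: lr_comp_apply image_image intro!: image_cong)
  then show "lr_comp X f g ` Y = Y"
    using assms(2,3) by (simp add: Omega_barD)
qed

lemma lr_comp_assoc: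
  assumes "f \<in> Omega_bar X Y"
  shows "lr_comp X (lr_comp X f g) h = lr_comp X f (lr_comp X g h)"
  using Omega_barD(2)[OF assms] by (simp add: lr_comp_def compose_assoc)

lemma identity_in_Omega_bar: "Y \<subseteq> X \<Longrightarrow> (\<lambda>x\<in>X. x) \<in> Omega_bar X Y"
  by (rule Omega_barI) (auto simp: subset_iff image_iff)

lemma lr_comp_identity:
  assumes "f \<in> Omega_bar X Y"
  shows "lr_comp X f (\<lambda>x\<in>X. x) = f" and "lr_comp X (\<lambda>x\<in>X. x) f = f"
  using Omega_barD(1)[OF assms] Id_compose[of f X X] compose_Id[of f X X]
  by (auto simp: lr_comp_def PiE_def)

section \<open>Sums of fibre cardinalities\<close>

text \<open>The fibres over distinct points are disjoint, so the disjoint sum is an ordinary union.\<close>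

lemma Csum_fibre_on:
  "(CSUM w : |P| . |fibre_on Y g w| ) =o |{z \<in> Y. g z \<in> P}|"
proof -
  have "bij_betw snd (SIGMA w : P. fibre_on Y g w) {z \<in> Y. g z \<in> P}"
    by (rule bij_betw_byWitness[where f' = "\<lambda>z. (g z, z)"]) (auto simp: fibre_on_def)
  then show ?thesis
    by (auto simp: Csum_def Field_card_of card_of_ordIso[symmetric])
qed

lemma Csum_fibre_on_le_iff:
  "(CSUM w : |P| . |fibre_on Y g w| ) \<le>o |A| \<longleftrightarrow> |{z \<in> Y. g z \<in> P}| \<le>o |A|"
  using ordIso_ordLeq_trans[OF Csum_fibre_on]
    ordIso_ordLeq_trans[OF ordIso_symmetric[OF Csum_fibre_on]] by blast

lemma in_J_set_iff:
  "f \<in> J_set X Y F \<longleftrightarrow> f \<in> Omega_bar X Y \<and>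
     (\<exists>g\<in>F. \<exists>P. indexed_partition Y P \<and> |f ` X - Y| \<le>o |g ` X - Y| \<and>
        (\<forall>y\<in>Y. |{z \<in> Y. g z \<in> P y}| \<le>o |fibre_on Y f y| ))"
  by (simp add: J_set_def Csum_fibre_on_le_iff)

section \<open>The cardinal conditions characterise the products \<open>h g k\<close>\<close>

text \<open>
  The fibres of \<open>k\<close> serve as the partition. Both inequalities hold because the smaller set lies in
  the image of the larger one, under \<open>k\<close> and \<open>h\<close> respectively.
\<close>

lemma product_satisfies_cardinal_conditions:
  assumes "Y \<subseteq> X" and h: "h \<in> Omega_bar X Y" and g: "g \<in> Omega_bar X Y"
    and k: "k \<in> Omega_bar X Y"
  defines "f \<equiv> lr_comp X (lr_comp X h g) k"
  shows "indexed_partition Y (fibre_on Y k)"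
    and "|f ` X - Y| \<le>o |g ` X - Y|"
    and "\<forall>y\<in>Y. |{z \<in> Y. g z \<in> fibre_on Y k y}| \<le>o |fibre_on Y f y|"
proof -
  have hX: "h x \<in> X" if "x \<in> X" for x using Omega_barD(2)[OF h] that by auto
  have f: "f x = k (g (h x))" if "x \<in> X" for x
    using that by (simp add: f_def lr_comp_apply)
  show "indexed_partition Y (fibre_on Y k)"
    unfolding indexed_partition_def
  proof (intro conjI)
    show "\<forall>y\<in>Y. fibre_on Y k y \<noteq> {}"
      using Omega_bar_surj[OF k] unfolding fibre_on_def by blast
    show "disjoint_family_on (fibre_on Y k) Y"
      by (auto simp: fibre_on_def disjoint_family_on_def)
    show "(\<Union>y\<in>Y. fibre_on Y k y) = Y"
      using Omega_bar_maps[OF k] by (auto simp: fibre_on_def)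
  qed
  \<comment> \<open>As \<open>k\<close> maps \<open>Y\<close> into \<open>Y\<close>, a value of \<open>f\<close> outside \<open>Y\<close> comes from a value of \<open>g\<close> outside \<open>Y\<close>.\<close>
  have "f ` X - Y \<subseteq> k ` (g ` X - Y)"
  proof
    fix u assume "u \<in> f ` X - Y"
    then obtain x where x: "x \<in> X" "u = k (g (h x))" "u \<notin> Y" using f by auto
    then have "g (h x) \<in> g ` X - Y" using hX Omega_bar_maps[OF k] by blast
    then show "u \<in> k ` (g ` X - Y)" using x(2) by blast
  qed
  then show "|f ` X - Y| \<le>o |g ` X - Y|"
    by (rule ordLeq_transitive[OF card_of_mono1 card_of_image])
  show "\<forall>y\<in>Y. |{z \<in> Y. g z \<in> fibre_on Y k y}| \<le>o |fibre_on Y f y|"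
  proof
    fix y
    have "{z \<in> Y. g z \<in> fibre_on Y k y} \<subseteq> h ` fibre_on Y f y"
    proof
      fix z assume "z \<in> {z \<in> Y. g z \<in> fibre_on Y k y}"
      then have z: "z \<in> Y" "k (g z) = y" by (auto simp: fibre_on_def)
      obtain x where "x \<in> Y" "h x = z" using Omega_bar_surj[OF h z(1)] .
      then show "z \<in> h ` fibre_on Y f y"
        using z(2) f \<open>Y \<subseteq> X\<close> by (auto simp: fibre_on_def)
    qed
    then show "|{z \<in> Y. g z \<in> fibre_on Y k y}| \<le>o |fibre_on Y f y|"
      by (rule ordLeq_transitive[OF card_of_mono1 card_of_image])
  qed
qed

text \<open>
  The map \<open>k\<close> must collapse each \<open>P y\<close> to \<open>y\<close>, and \<open>h\<close> must map each fibre of \<open>f\<close> over \<open>y \<in> Y\<close> into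
  the \<open>g\<close>-preimage of \<open>P y\<close>. That \<open>h\<close> maps \<open>Y\<close> onto \<open>Y\<close> is where the inequalities on fibres are
  needed; that \<open>k\<close> can recover the values of \<open>f\<close> outside \<open>Y\<close> is where the inequality on
  \<open>f ` X - Y\<close> is needed.
\<close>

lemma product_from_cardinal_conditions:
  assumes "Y \<noteq> {}" and YX: "Y \<subseteq> X"
    and f: "f \<in> Omega_bar X Y" and g: "g \<in> Omega_bar X Y"
    and P: "indexed_partition Y P"
    and outside: "|f ` X - Y| \<le>o |g ` X - Y|"
    and fibres: "\<forall>y\<in>Y. |{z \<in> Y. g z \<in> P y}| \<le>o |fibre_on Y f y|"
  obtains h k where "h \<in> Omega_bar X Y" and "k \<in> Omega_bar X Y"
    and "f = lr_comp X (lr_comp X h g) k"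
proof -
  define U where "U y = {z \<in> Y. g z \<in> P y}" for y
  have fX: "\<And>x. x \<in> X \<Longrightarrow> f x \<in> X" and gX: "\<And>x. x \<in> X \<Longrightarrow> g x \<in> X"
    using Omega_barD(2)[OF f] Omega_barD(2)[OF g] by auto
  have PY: "P y \<subseteq> Y" "P y \<noteq> {}" if "y \<in> Y" for y
    using P that by (auto simp: indexed_partition_def)
  have P_cover: "\<exists>y\<in>Y. w \<in> P y" if "w \<in> Y" for w
    using P that by (auto simp: indexed_partition_def)
  have P_unique: "y = y'" if "y \<in> Y" "y' \<in> Y" "w \<in> P y" "w \<in> P y'" for y y' w
    using P that by (auto simp: indexed_partition_def disjoint_family_on_def)
  have U_ne: "U y \<noteq> {}" if "y \<in> Y" for y
  proof -
    obtain w where w: "w \<in> P y" "w \<in> Y" using PY[OF \<open>y \<in> Y\<close>] by blast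
    obtain z where "z \<in> Y" "g z = w" using Omega_bar_surj[OF g w(2)] .
    then show ?thesis using w(1) by (auto simp: U_def)
  qed
  have "\<forall>y\<in>Y. \<exists>s. s ` fibre_on Y f y = U y"
  proof
    fix y assume "y \<in> Y"
    then have "|U y| \<le>o |fibre_on Y f y|" using fibres by (simp add: U_def)
    then show "\<exists>s. s ` fibre_on Y f y = U y"
      using card_of_ordLeq2[OF U_ne[OF \<open>y \<in> Y\<close>]] by blast
  qed
  from bchoice[OF this] obtain s where s: "\<And>y. y \<in> Y \<Longrightarrow> s y ` fibre_on Y f y = U y"
    by blast
  obtain \<phi> where \<phi>_inj: "inj_on \<phi> (f ` X - Y)"
    and \<phi>_im: "\<phi> ` (f ` X - Y) \<subseteq> g ` X - Y"
    using card_of_ordLeq[THEN iffD2, OF outside] by blast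
  obtain y0 where y0: "y0 \<in> Y" using \<open>Y \<noteq> {}\<close> by blast

  \<comment> \<open>A point of \<open>X\<close> outside \<open>Y\<close> and outside the range of \<open>\<phi>\<close> is never reached by \<open>h g\<close>; \<open>y0\<close> is an
      arbitrary value there.\<close>
  define k where "k = (\<lambda>w\<in>X. if w \<in> Y then THE y. y \<in> Y \<and> w \<in> P y
     else if w \<in> \<phi> ` (f ` X - Y) then inv_into (f ` X - Y) \<phi> w else y0)"
  \<comment> \<open>In the second branch any point of \<open>U (f x)\<close> will do, since \<open>s\<close> already makes \<open>h\<close> onto \<open>Y\<close>.\<close>
  define h where "h = (\<lambda>x\<in>X. if x \<in> Y then s (f x) x
     else if f x \<in> Y then (SOME z. z \<in> U (f x))
     else inv_into X g (\<phi> (f x)))"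

  have k_P: "k w = y" if "y \<in> Y" "w \<in> P y" for w y
  proof -
    have "w \<in> Y" using PY that by blast
    moreover have "(THE y. y \<in> Y \<and> w \<in> P y) = y"
      by (rule the_equality) (use that P_unique in blast)+
    ultimately show ?thesis using YX by (auto simp: k_def)
  qed
  have k_\<phi>: "k (\<phi> u) = u" if "u \<in> f ` X - Y" for u
  proof -
    have "\<phi> u \<in> g ` X - Y" using \<phi>_im that by blast
    then show ?thesis using that \<phi>_inj gX by (auto simp: k_def)
  qed
  have h_Y: "h x \<in> U (f x)" if "x \<in> Y" for x
  proof -
    have "f x \<in> Y" "x \<in> fibre_on Y f (f x)"
      using that Omega_bar_maps[OF f] by (auto simp: fibre_on_def)
    then show ?thesis using s that YX by (auto simp: h_def)
  qed
  have h_U: "h x \<in> U (f x)" if "x \<in> X" "f x \<in> Y" for x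
  proof (cases "x \<in> Y")
    case False
    then show ?thesis using that U_ne by (simp add: h_def some_in_eq)
  qed (rule h_Y)
  have h_out: "h x \<in> X \<and> g (h x) = \<phi> (f x)" if "x \<in> X" "f x \<notin> Y" for x
  proof -
    have "\<phi> (f x) \<in> g ` X" using \<phi>_im that by blast
    moreover have "x \<notin> Y" using that Omega_bar_maps[OF f] by blast
    ultimately show ?thesis
      using that by (simp add: h_def inv_into_into f_inv_into_f)
  qed

  have "h \<in> Omega_bar X Y"
  proof (rule Omega_barI)
    have "h x \<in> X" if "x \<in> X" for x
      using h_U[OF that] h_out[OF that] YX by (auto simp: U_def)
    then show "h \<in> X \<rightarrow>\<^sub>E X" by (auto simp: h_def)
    show "h ` Y = Y"
    proof
      show "h ` Y \<subseteq> Y" using h_Y unfolding U_def by blast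
      show "Y \<subseteq> h ` Y"
      proof
        fix z assume "z \<in> Y"
        then obtain y where "y \<in> Y" "z \<in> U y"
          using P_cover[OF Omega_bar_maps[OF g]] unfolding U_def by blast
        then have "z \<in> s y ` fibre_on Y f y" using s by simp
        then obtain x where "x \<in> fibre_on Y f y" "z = s y x" by blast
        then show "z \<in> h ` Y" using YX by (auto simp: h_def fibre_on_def)
      qed
    qed
  qed
  moreover have "k \<in> Omega_bar X Y"
  proof (rule Omega_barI)
    have k_Y: "k w \<in> Y" if "w \<in> Y" for w
      using P_cover[OF that] k_P by blast
    have "k w \<in> X" if "w \<in> X" for w
    proof -
      consider "w \<in> Y" | "w \<notin> Y" "w \<in> \<phi> ` (f ` X - Y)" | "w \<notin> Y" "w \<notin> \<phi> ` (f ` X - Y)"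
        by blast
      then show ?thesis
      proof cases
        case 1
        then show ?thesis using k_Y YX by blast
      next
        case 2
        then show ?thesis using k_\<phi> fX by auto
      next
        case 3
        then show ?thesis using that y0 YX by (auto simp: k_def)
      qed
    qed
    then show "k \<in> X \<rightarrow>\<^sub>E X" by (auto simp: k_def)
    show "k ` Y = Y"
    proof
      show "k ` Y \<subseteq> Y" using k_Y by blast
      show "Y \<subseteq> k ` Y"
      proof
        fix y assume "y \<in> Y"
        then obtain w where "w \<in> P y" "w \<in> Y" using PY by blast
        then show "y \<in> k ` Y" using k_P[OF \<open>y \<in> Y\<close>] by blast
      qed
    qed
  qed
  moreover have "f = lr_comp X (lr_comp X h g) k"
  proof
    fix x
    show "f x = lr_comp X (lr_comp X h g) k x"
    proof (cases "x \<in> X")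
      case True
      have "k (g (h x)) = f x"
      proof (cases "f x \<in> Y")
        case inY: True
        then show ?thesis using h_U[OF True] k_P by (auto simp: U_def)
      next
        case False
        then show ?thesis using h_out[OF True] k_\<phi> True by auto
      qed
      then show ?thesis using True by (simp add: lr_comp_apply)
    next
      case False
      then show ?thesis
        using Omega_barD(1)[OF f] by (auto simp: lr_comp_def compose_def)
    qed
  qed
  ultimately show ?thesis by (rule that)
qed

text \<open>
  In this form \<open>J_set X Y F\<close> no longer mentions cardinals, and what remains is true of the
  two-sided ideals of every monoid.
\<close>

lemma in_J_set_iff_product:
  assumes "Y \<noteq> {}" and "Y \<subseteq> X" and "F \<subseteq> Omega_bar X Y"
  shows "f \<in> J_set X Y F \<longleftrightarrow>
    (\<exists>h\<in>Omega_bar X Y. \<exists>g\<in>F. \<exists>k\<in>Omega_bar X Y. f = lr_comp X (lr_comp X h g) k)"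
    (is "_ \<longleftrightarrow> ?product")
proof
  assume "f \<in> J_set X Y F"
  then obtain g P where f: "f \<in> Omega_bar X Y" and "g \<in> F" and P: "indexed_partition Y P"
    "|f ` X - Y| \<le>o |g ` X - Y|" "\<forall>y\<in>Y. |{z \<in> Y. g z \<in> P y}| \<le>o |fibre_on Y f y|"
    unfolding in_J_set_iff by blast
  have "g \<in> Omega_bar X Y" using \<open>g \<in> F\<close> assms(3) by blast
  from product_from_cardinal_conditions[OF assms(1,2) f this P] show ?product
    using \<open>g \<in> F\<close> by blast
next
  assume ?product
  then obtain h g k where h: "h \<in> Omega_bar X Y" and g: "g \<in> F" and k: "k \<in> Omega_bar X Y"
    and f: "f = lr_comp X (lr_comp X h g) k" by blast
  have g': "g \<in> Omega_bar X Y" using g assms(3) by blast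
  show "f \<in> J_set X Y F"
    unfolding in_J_set_iff f
    using product_satisfies_cardinal_conditions[OF assms(2) h g' k] g
      lr_comp_closed[OF assms(2)] h g' k by blast
qed

section \<open>Ideals\<close>

lemma J_set_ideal:
  assumes "Y \<noteq> {}" and YX: "Y \<subseteq> X" and F: "F \<subseteq> Omega_bar X Y" and "F \<noteq> {}"
  shows "semigroup_ideal (Omega_bar X Y) (lr_comp X) (J_set X Y F)"
proof -
  note J_iff = in_J_set_iff_product[OF assms(1-3)]
  note closed = lr_comp_closed[OF YX]
  obtain g where "g \<in> F" using \<open>F \<noteq> {}\<close> by blast
  then have "lr_comp X (lr_comp X (\<lambda>x\<in>X. x) g) (\<lambda>x\<in>X. x) \<in> J_set X Y F"
    using identity_in_Omega_bar[OF YX] J_iff by blast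
  moreover have "lr_comp X s a \<in> J_set X Y F" "lr_comp X a s \<in> J_set X Y F"
    if s: "s \<in> Omega_bar X Y" and a: "a \<in> J_set X Y F" for s a
  proof -
    from a obtain h g k where h: "h \<in> Omega_bar X Y" and g: "g \<in> F" and k: "k \<in> Omega_bar X Y"
      and a_eq: "a = lr_comp X (lr_comp X h g) k" using J_iff by blast
    have hg: "lr_comp X h g \<in> Omega_bar X Y" using closed h g F by blast
    have "lr_comp X s a = lr_comp X (lr_comp X (lr_comp X s h) g) k"
      using s closed[OF s h] by (simp add: a_eq lr_comp_assoc)
    moreover have "lr_comp X a s = lr_comp X (lr_comp X h g) (lr_comp X k s)"
      using hg by (simp add: a_eq lr_comp_assoc)
    ultimately show "lr_comp X s a \<in> J_set X Y F" "lr_comp X a s \<in> J_set X Y F"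
      using J_iff closed s h g k by blast+
  qed
  moreover have "J_set X Y F \<subseteq> Omega_bar X Y"
    using in_J_set_iff by blast
  ultimately show ?thesis
    unfolding semigroup_ideal_def by blast
qed

lemma ideal_eq_J_set:
  assumes "Y \<noteq> {}" and YX: "Y \<subseteq> X"
    and I: "semigroup_ideal (Omega_bar X Y) (lr_comp X) I"
  shows "I = J_set X Y I"
proof
  have I_sub: "I \<subseteq> Omega_bar X Y" using I by (simp add: semigroup_ideal_def)
  note J_iff = in_J_set_iff_product[OF assms(1,2) I_sub]
  show "I \<subseteq> J_set X Y I"
  proof
    fix f assume "f \<in> I"
    then have "f \<in> Omega_bar X Y" using I_sub by blast
    then have "f = lr_comp X (lr_comp X (\<lambda>x\<in>X. x) f) (\<lambda>x\<in>X. x)"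
      by (simp add: lr_comp_identity)
    then show "f \<in> J_set X Y I"
      using \<open>f \<in> I\<close> identity_in_Omega_bar[OF YX] J_iff by blast
  qed
  show "J_set X Y I \<subseteq> I"
    using I J_iff by (auto simp: semigroup_ideal_def)
qed

theorem theorem5p6:
  fixes X Y :: "'a set" and I :: "('a \<Rightarrow> 'a) set"
  assumes "X \<noteq> {}" and "Y \<noteq> {}" and "Y \<subseteq> X"
    and "I \<subseteq> Omega_bar X Y"
  shows "semigroup_ideal (Omega_bar X Y) (lr_comp X) I \<longleftrightarrow>
    (\<exists>F. F \<noteq> {} \<and> F \<subseteq> Omega_bar X Y \<and> I = J_set X Y F)"
proof
  assume I: "semigroup_ideal (Omega_bar X Y) (lr_comp X) I"
  then have "I \<noteq> {}" by (simp add: semigroup_ideal_def)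
  then show "\<exists>F. F \<noteq> {} \<and> F \<subseteq> Omega_bar X Y \<and> I = J_set X Y F"
    using ideal_eq_J_set[OF assms(2,3) I] assms(4) by blast
next
  assume "\<exists>F. F \<noteq> {} \<and> F \<subseteq> Omega_bar X Y \<and> I = J_set X Y F"
  then show "semigroup_ideal (Omega_bar X Y) (lr_comp X) I"
    using J_set_ideal[OF assms(2,3)] by blast
qed

end
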